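(* Let $G$ be a simple connected undirected graph with $n$ vertices, let $\rho_1\ge\rho_2\ge\cdots\ge\rho_n$ be its distance eigenvalues, and let $n^{+}$ and $n^{-}$ be the number of positive and of negative distance eigenvalues of $G$ (counted with multiplicity), respectively. Then for every $1\le t\le n$, $$-\sqrt{\frac{S_D(G)\,n^{+}}{(n-t+1)(n-t+1+n^{+})}}\;\le\; \rho_t \;\le\; \sqrt{\frac{S_D(G)\,n^{-}}{t(t+n^{-})}}.$$
   Context: For a connected graph $G$ with vertices $v_1,\dots,v_n$, the distance matrix $D(G)$ is the $n\times n$ symmetric matrix whose $(i,j)$ entry is the shortest-path distance $d_G(v_i,v_j)$. The distance eigenvalues of $G$ are the eigenvalues $\rho_1\ge\cdots\ge\rho_n$ of $D(G)$, listed with multiplicity. $S_D(G)=\sum_{i=1}^n\rho_i^2=\sum_{i=1}^n\sum_{j=1}^n d_G(v_i,v_j)^2$. *)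

theory Defs
  imports
    "Graph_Theory.Graph_Theory"
    "Jordan_Normal_Form.Char_Poly"
    "Jordan_Normal_Form.Schur_Decomposition"
begin

text \<open>
  Graphs are those of the AFP entry Graph_Theory: the locale \<^locale>\<open>graph\<close> describes finite
  symmetric digraphs without loops and parallel arcs, i.e. finite simple undirected graphs.
\<close>

definition graph_dist :: "('a, 'b) pre_digraph \<Rightarrow> 'a \<Rightarrow> 'a \<Rightarrow> nat" where
  "graph_dist G u v = (LEAST k. \<exists>p. pre_digraph.apath G u p v \<and> length p = k)"

text \<open>The list \<open>vs\<close> enumerates the vertices \<open>v\<^sub>1, \<dots>, v\<^sub>n\<close> (as \<open>vs ! 0, \<dots>, vs ! (n - 1)\<close>).\<close>

definition distance_matrix :: "('a, 'b) pre_digraph \<Rightarrow> 'a list \<Rightarrow> real mat" where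
  "distance_matrix G vs =
     mat (length vs) (length vs) (\<lambda>(i, j). real (graph_dist G (vs ! i) (vs ! j)))"

text \<open>
  The distance eigenvalues in decreasing order, with multiplicity; \<open>\<rho>\<^sub>t\<close> is
  \<open>distance_eigenvalues G vs ! (t - 1)\<close>.  That no eigenvalue is lost by taking only the real roots
  of the characteristic polynomial is \<open>length_distance_eigenvalues\<close> below.
\<close>

definition distance_eigenvalues :: "('a, 'b) pre_digraph \<Rightarrow> 'a list \<Rightarrow> real list" where
  "distance_eigenvalues G vs =
     rev (sorted_list_of_multiset (proots (char_poly (distance_matrix G vs))))"

definition n_plus :: "('a, 'b) pre_digraph \<Rightarrow> 'a list \<Rightarrow> nat" where
  "n_plus G vs = length (filter (\<lambda>x. x > 0) (distance_eigenvalues G vs))"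

definition n_minus :: "('a, 'b) pre_digraph \<Rightarrow> 'a list \<Rightarrow> nat" where
  "n_minus G vs = length (filter (\<lambda>x. x < 0) (distance_eigenvalues G vs))"

definition S_D :: "('a, 'b) pre_digraph \<Rightarrow> 'a list \<Rightarrow> real" where
  "S_D G vs = (\<Sum>\<rho>\<leftarrow>distance_eigenvalues G vs. \<rho>\<^sup>2)"


subsection \<open>The definitions agree with the expected ones\<close>

context graph
begin

lemma graph_dist_eq_shortest_path:
  assumes "Digraph_Component.connected G" "u \<in> verts G" "v \<in> verts G"
  shows "\<mu> (\<lambda>_. 1) u v = ereal (real (graph_dist G u v))"
proof -
  have sym: "symmetric G" by (rule sym_arcs)
  have "u \<rightarrow>\<^sup>* v"
    using assms reachable_mk_symmetric_eq[OF sym]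
    by (auto simp: Digraph_Component.connected_def strongly_connected_def)
  then obtain p0 where p0: "apath u p0 v" by (auto simp: reachable_apath)
  have cost: "awalk_cost (\<lambda>_. 1) p = real (length p)" for p
    by (induction p) auto
  obtain p where p: "apath u p v" "\<mu> (\<lambda>_. 1) u v = ereal (awalk_cost (\<lambda>_. 1) p)"
    using min_cost_awalk[OF \<open>u \<rightarrow>\<^sup>* v\<close>, of "\<lambda>_. 1"] by auto
  have "graph_dist G u v = length p"
    unfolding graph_dist_def
  proof (rule Least_equality)
    fix k assume "\<exists>q. apath u q v \<and> length q = k"
    then obtain q where q: "apath u q v" "length q = k" by blast
    then have "\<mu> (\<lambda>_. 1) u v \<le> ereal (awalk_cost (\<lambda>_. 1) q)"
      by (intro min_cost_le_walk_cost) (auto simp: apath_def)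
    with p q show "length p \<le> k" by (simp add: cost)
  qed (use p in blast)
  with p show ?thesis by (simp add: cost)
qed

lemma awalk_reverse:
  assumes "awalk u p v"
  shows "\<exists>q. awalk v q u \<and> length q = length p"
  using assms
proof (induction p arbitrary: u)
  case Nil
  then show ?case by (auto simp: awalk_Nil_iff intro!: exI[of _ "[]"])
next
  case (Cons e p)
  then have e: "e \<in> arcs G" "tail G e = u" "awalk (head G e) p v"
    by (auto simp: awalk_Cons_iff)
  from Cons.IH[OF e(3)] obtain q where q: "awalk v q (head G e)" "length q = length p" by blast
  from sym_arcs e(1) obtain e' where e': "e' \<in> arcs G" "tail G e' = head G e" "head G e' = u"
    unfolding symmetric_conv using e(2) by metis
  have "awalk (head G e) [e'] u" using e' by (metis arc_implies_awalk)
  with q have "awalk v (q @ [e']) u" by (rule_tac awalk_appendI) auto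
  with q show ?case by (intro exI[of _ "q @ [e']"]) auto
qed

lemma graph_dist_commute:
  assumes "Digraph_Component.connected G" "u \<in> verts G" "v \<in> verts G"
  shows "graph_dist G u v = graph_dist G v u"
proof -
  have "\<mu> (\<lambda>_. 1) x y \<le> \<mu> (\<lambda>_. 1) y x" for x y
    unfolding \<mu>_def
  proof (rule INF_greatest)
    fix p assume "p \<in> {p. awalk y p x}"
    then obtain q where q: "awalk x q y" "length q = length p" using awalk_reverse by blast
    have cost: "awalk_cost (\<lambda>_. 1) p = real (length p)" for p
      by (induction p) auto
    show "(INF p\<in>{p. awalk x p y}. ereal (awalk_cost (\<lambda>_. 1) p)) \<le> ereal (awalk_cost (\<lambda>_. 1) p)"
      by (rule INF_lower2[of q]) (use q in \<open>auto simp: cost\<close>)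
  qed
  then have "\<mu> (\<lambda>_. 1) u v = \<mu> (\<lambda>_. 1) v u" by (intro antisym)
  then show ?thesis using assms by (simp add: graph_dist_eq_shortest_path)
qed

end

lemma char_poly_real_symmetric_splits:
  fixes A :: "real mat"
  assumes A: "A \<in> carrier_mat n n" and sym: "\<And>i j. i < n \<Longrightarrow> j < n \<Longrightarrow> A $$ (i, j) = A $$ (j, i)"
  shows "\<exists>es. char_poly A = (\<Prod>a\<leftarrow>es. [:- a, 1:]) \<and> length es = n"
proof -
  let ?C = "map_mat complex_of_real A"
  have C: "?C \<in> carrier_mat n n" using A by simp
  interpret h: inj_comm_ring_hom complex_of_real by standard auto
  interpret mh: map_poly_inj_comm_ring_hom complex_of_real ..
  from char_poly_factorized[OF C] obtain as
    where as: "char_poly ?C = (\<Prod>a\<leftarrow>as. [:- a, 1:])" "length as = n" by blast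
  have real: "complex_of_real (Re a) = a" if "a \<in> set as" for a
  proof -
    have "poly (char_poly ?C) a = 0" using that
      by (simp add: as poly_prod_list prod_list_zero_iff)
    then have "eigenvalue ?C a" using eigenvalue_root_char_poly[OF C] by simp
    then obtain v where v: "v \<in> carrier_vec n" "v \<noteq> 0\<^sub>v n" "?C *\<^sub>v v = a \<cdot>\<^sub>v v"
      using C by (auto simp: eigenvalue_def eigenvector_def)
    have row: "(\<Sum>j<n. of_real (A $$ (i, j)) * v $ j) = a * v $ i" if "i < n" for i
    proof -
      have "(?C *\<^sub>v v) $ i = (\<Sum>j<n. of_real (A $$ (i, j)) * v $ j)"
        using that A v(1) by (auto simp: scalar_prod_def atLeast0LessThan intro!: sum.cong)
      with v that show ?thesis by simp
    qed
    define N where "N = (\<Sum>i<n. (cmod (v $ i))\<^sup>2)"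
    define q where "q = (\<Sum>i<n. cnj (v $ i) * (\<Sum>j<n. of_real (A $$ (i, j)) * v $ j))"
    have q1: "q = a * of_real N"
    proof -
      have "q = (\<Sum>i<n. cnj (v $ i) * (a * v $ i))"
        unfolding q_def by (intro sum.cong refl) (simp only: lessThan_iff row)
      also have "\<dots> = (\<Sum>i<n. a * of_real ((cmod (v $ i))\<^sup>2))"
        by (intro sum.cong refl) (simp only: complex_norm_square mult_ac)
      finally show ?thesis by (simp only: N_def of_real_sum sum_distrib_left)
    qed
    have "cnj q = (\<Sum>i<n. \<Sum>j<n. v $ i * of_real (A $$ (i, j)) * cnj (v $ j))"
      by (simp add: q_def sum_distrib_left mult_ac)
    also have "\<dots> = (\<Sum>j<n. \<Sum>i<n. v $ i * of_real (A $$ (i, j)) * cnj (v $ j))"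
      by (rule sum.swap)
    also have "\<dots> = q"
      unfolding q_def sum_distrib_left
      by (intro sum.cong) (auto simp: sym mult_ac)
    finally have "cnj a * of_real N = a * of_real N" using q1 by simp
    moreover have "N \<noteq> 0"
    proof
      assume "N = 0"
      then have "\<forall>i<n. v $ i = 0" unfolding N_def by (subst (asm) sum_nonneg_eq_0_iff) auto
      with v(1,2) show False by (auto simp: vec_eq_iff)
    qed
    ultimately have "cnj a = a" by simp
    then show ?thesis by (metis Reals_cnj_iff complex_is_Real_iff of_real_Re)
  qed
  have "map_poly complex_of_real (char_poly A) = char_poly ?C"
    by (rule of_real_hom.char_poly_hom[OF A, symmetric])
  also have "\<dots> = map_poly complex_of_real (\<Prod>a\<leftarrow>map Re as. [:- a, 1:])"
    unfolding as mh.hom_prod_list map_map o_def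
    by (intro arg_cong[of _ _ prod_list] map_cong) (auto simp: real)
  finally have "char_poly A = (\<Prod>a\<leftarrow>map Re as. [:- a, 1:])" by simp
  with as(2) show ?thesis by (intro exI[of _ "map Re as"]) simp
qed

lemma proots_linear_factors: "proots (\<Prod>a\<leftarrow>es. [:- a, 1:]) = mset (es :: real list)"
proof (induction es)
  case (Cons a es)
  have "(\<Prod>a\<leftarrow>es. [:- a, 1:]) \<noteq> 0" by (auto simp: prod_list_zero_iff)
  with Cons show ?case by (simp add: proots_mult del: mult_pCons_left)
qed auto

lemma sum_list_eigenvalues_squared:
  fixes A :: "real mat"
  assumes A: "A \<in> carrier_mat n n" and es: "char_poly A = (\<Prod>a\<leftarrow>es. [:- a, 1:])"
  shows "(\<Sum>x\<leftarrow>es. x\<^sup>2) = (\<Sum>i<n. \<Sum>j<n. A $$ (i, j) * A $$ (j, i))"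
proof -
  define tr where "tr M = (\<Sum>i<n. (M :: real mat) $$ (i, i))" for M
  have tr_mult: "tr (M * N) = (\<Sum>i<n. \<Sum>j<n. M $$ (i, j) * N $$ (j, i))"
    if "M \<in> carrier_mat n n" "N \<in> carrier_mat n n" for M N
    using that by (auto simp: tr_def scalar_prod_def atLeast0LessThan intro!: sum.cong)
  have tr_comm: "tr (M * N) = tr (N * M)"
    if "M \<in> carrier_mat n n" "N \<in> carrier_mat n n" for M N
    using that by (simp add: tr_mult) (subst sum.swap, simp add: mult_ac)
  obtain B where B: "B \<in> carrier_mat n n" "upper_triangular B" "similar_mat A B"
    using schur_decomposition_exists[OF A es] by blast
  obtain P Q where PQ: "P \<in> carrier_mat n n" "Q \<in> carrier_mat n n" "Q * P = 1\<^sub>m n" "A = P * B * Q"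
    using B(3) A unfolding similar_mat_def similar_mat_wit_def Let_def by auto
  have "A * A = P * B * Q * (P * B * Q)" by (simp add: PQ)
  also have "\<dots> = P * B * (Q * P) * (B * Q)"
    using PQ(1,2) B(1) by (simp add: assoc_mult_mat[of _ n n _ n _ n])
  also have "\<dots> = P * (B * B * Q)"
    unfolding PQ(3) using PQ(1,2) B(1) by (simp add: assoc_mult_mat[of _ n n _ n _ n])
  finally have "tr (A * A) = tr (P * (B * B * Q))" by simp
  also have "\<dots> = tr (B * B * Q * P)"
    by (rule tr_comm) (use PQ(1,2) B(1) in auto)
  also have "B * B * Q * P = B * B"
    using PQ(1-3) B(1) by (simp add: assoc_mult_mat[of _ n n _ n _ n])
  also have "tr (B * B) = (\<Sum>i<n. (B $$ (i, i))\<^sup>2)"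
    unfolding tr_mult[OF B(1) B(1)]
  proof (intro sum.cong refl)
    fix i assume i: "i \<in> {..<n}"
    have "(\<Sum>j<n. B $$ (i, j) * B $$ (j, i)) = (\<Sum>j<n. if j = i then (B $$ (i, i))\<^sup>2 else 0)"
    proof (intro sum.cong refl)
      fix j assume "j \<in> {..<n}"
      with i show "B $$ (i, j) * B $$ (j, i) = (if j = i then (B $$ (i, i))\<^sup>2 else 0)"
        using B(1,2) i
        by (cases i j rule: linorder_cases) (auto simp: power2_eq_square upper_triangular_def)
    qed
    with i show "(\<Sum>j<n. B $$ (i, j) * B $$ (j, i)) = (B $$ (i, i))\<^sup>2" by simp
  qed
  also have "\<dots> = (\<Sum>x\<leftarrow>diag_mat B. x\<^sup>2)"
    using B(1) by (simp add: diag_mat_def o_def sum_list_sum_nth atLeast0LessThan)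
  also have "(\<Sum>x\<leftarrow>diag_mat B. x\<^sup>2) = (\<Sum>x\<leftarrow>es. x\<^sup>2)"
  proof -
    have "mset (diag_mat B) = mset es"
      using char_poly_upper_triangular[OF B(1,2)] char_poly_similar[OF B(3)] es
      by (metis proots_linear_factors)
    then show ?thesis by (metis mset_map sum_mset_sum_list)
  qed
  finally show ?thesis by (simp add: tr_mult[OF A A])
qed

lemma distance_matrix_splits:
  assumes "Digraph.graph G" "Digraph_Component.connected G" "set vs = verts G"
  obtains es where "char_poly (distance_matrix G vs) = (\<Prod>a\<leftarrow>es. [:- a, 1:])"
    "length es = length vs" "mset (distance_eigenvalues G vs) = mset es"
proof -
  interpret graph G by fact
  have "distance_matrix G vs \<in> carrier_mat (length vs) (length vs)"
    by (simp add: distance_matrix_def)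
  moreover have "distance_matrix G vs $$ (i, j) = distance_matrix G vs $$ (j, i)"
    if "i < length vs" "j < length vs" for i j
    using that graph_dist_commute[OF assms(2), of "vs ! i" "vs ! j"] assms(3)
    by (force simp: distance_matrix_def)
  ultimately obtain es where es: "char_poly (distance_matrix G vs) = (\<Prod>a\<leftarrow>es. [:- a, 1:])"
      "length es = length vs"
    using char_poly_real_symmetric_splits by metis
  moreover from es have "mset (distance_eigenvalues G vs) = mset es"
    by (simp add: distance_eigenvalues_def proots_linear_factors)
  ultimately show ?thesis using that by blast
qed

lemma length_distance_eigenvalues:
  assumes "Digraph.graph G" "Digraph_Component.connected G" "set vs = verts G"
  shows "length (distance_eigenvalues G vs) = length vs"
  using distance_matrix_splits[OF assms] by (metis size_mset)

lemma S_D_eq_sum_distances: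
  assumes "Digraph.graph G" "Digraph_Component.connected G" "distinct vs" "set vs = verts G"
  shows "S_D G vs = (\<Sum>u\<in>verts G. \<Sum>v\<in>verts G. (real (graph_dist G u v))\<^sup>2)"
proof -
  interpret graph G by fact
  obtain es where es: "char_poly (distance_matrix G vs) = (\<Prod>a\<leftarrow>es. [:- a, 1:])"
    "mset (distance_eigenvalues G vs) = mset es"
    using distance_matrix_splits[OF assms(1,2,4)] by blast
  let ?n = "length vs" and ?d = "\<lambda>u v. real (graph_dist G u v)"
  have car: "distance_matrix G vs \<in> carrier_mat ?n ?n" by (simp add: distance_matrix_def)
  have "S_D G vs = (\<Sum>x\<leftarrow>es. x\<^sup>2)"
    unfolding S_D_def using es(2) by (metis mset_map sum_mset_sum_list)
  also have "\<dots> = (\<Sum>i<?n. \<Sum>j<?n. ?d (vs ! i) (vs ! j) * ?d (vs ! j) (vs ! i))"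
    unfolding sum_list_eigenvalues_squared[OF car es(1)]
    by (intro sum.cong) (auto simp: distance_matrix_def)
  also have "\<dots> = (\<Sum>i<?n. \<Sum>j<?n. (?d (vs ! i) (vs ! j))\<^sup>2)"
  proof (intro sum.cong refl)
    fix i j assume "i \<in> {..<?n}" "j \<in> {..<?n}"
    then have "vs ! i \<in> set vs" "vs ! j \<in> set vs" by simp_all
    then show "?d (vs ! i) (vs ! j) * ?d (vs ! j) (vs ! i) = (?d (vs ! i) (vs ! j))\<^sup>2"
      using graph_dist_commute[OF assms(2), of "vs ! i" "vs ! j"] assms(4)
      by (simp only: power2_eq_square)
  qed
  also have "\<dots> = (\<Sum>u\<in>verts G. \<Sum>v\<in>verts G. (?d u v)\<^sup>2)"
  proof -
    have bij: "bij_betw ((!) vs) {..<?n} (verts G)"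
      using bij_betw_nth[OF assms(3) refl] assms(4) by metis
    show ?thesis
      by (subst (1 2) sum.reindex_bij_betw[OF bij, symmetric]) (rule refl)
  qed
  finally show ?thesis .
qed

end

theory Submission
  imports Defs "HOL-Analysis.Convex"
begin

text \<open>
  The distance matrix has zero diagonal, so its eigenvalues sum to its trace \<open>0\<close>: the positive
  eigenvalues have the same sum \<open>P\<close> as the absolute values of the negative ones.  The upper bound
  is nonnegative, so suppose that \<open>\<rho>\<^sub>t > 0\<close>.  Each of the \<open>t\<close> largest eigenvalues is at least
  \<open>\<rho>\<^sub>t\<close>, so they contribute at least \<open>t \<rho>\<^sub>t\<^sup>2\<close> to \<open>S\<^sub>D\<close>, and \<open>P \<ge> t \<rho>\<^sub>t\<close>.  By the
  Cauchy--Schwarz inequality the \<open>n\<^sup>-\<close> negative eigenvalues contribute at least \<open>P\<^sup>2 / n\<^sup>-\<close>.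
  Altogether \<open>S\<^sub>D \<ge> t \<rho>\<^sub>t\<^sup>2 + t\<^sup>2 \<rho>\<^sub>t\<^sup>2 / n\<^sup>-\<close>, which is the upper bound.

  The lower bound is the same statement for the negated eigenvalues, of which \<open>n - t + 1\<close> are at
  least \<open>- \<rho>\<^sub>t\<close> and \<open>n\<^sup>+\<close> are negative.  Both halves are therefore instances of
  \<open>zero_sum_bound\<close>, a fact about finite families of reals with zero sum, and the graph enters
  through \<open>sum_distance_eigenvalues\<close>.
\<close>

text \<open>
  For \<open>c > 0\<close>, the terms in \<open>B\<close> contribute at least \<open>card B * c\<^sup>2\<close> to the sum of squares, and they
  force the negative terms to sum to at most \<open>- card B * c\<close>; Cauchy--Schwarz turns this into a
  lower bound for the squares of the negative terms.  Describing the large terms by a set \<open>B\<close>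
  rather than by a position in a sorted list lets the lemma apply to a decreasing sequence, with
  \<open>B\<close> an initial segment, and to its negation, with \<open>B\<close> a final segment.
\<close>

lemma zero_sum_bound:
  fixes f :: "'a \<Rightarrow> real"
  assumes fin: "finite I" and zero: "sum f I = 0"
    and B: "B \<subseteq> I" "B \<noteq> {}" "\<And>i. i \<in> B \<Longrightarrow> c \<le> f i"
  shows "c \<le> sqrt ((\<Sum>i\<in>I. (f i)\<^sup>2) * real (card {i \<in> I. f i < 0})
                 / (real (card B) * (real (card B) + real (card {i \<in> I. f i < 0}))))"
proof (cases "c > 0")
  case False
  then have "c \<le> 0" by simp
  also have "0 \<le> sqrt ((\<Sum>i\<in>I. (f i)\<^sup>2) * real (card {i \<in> I. f i < 0})
                 / (real (card B) * (real (card B) + real (card {i \<in> I. f i < 0}))))"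
    by (simp add: sum_nonneg)
  finally show ?thesis .
next
  case True
  define N where "N = {i \<in> I. f i < 0}"
  define b where "b = real (card B)"
  define m where "m = real (card N)"
  have N: "N \<subseteq> I" "finite N" and finB: "finite B"
    using fin B(1) by (auto simp: N_def intro: finite_subset)
  have BN: "B \<subseteq> I - N" using B(1,3) True by (force simp: N_def)
  have b: "b > 0" using B(2) finB by (simp add: b_def card_gt_0_iff)
  have m: "m \<ge> 0" by (simp add: m_def)
  have "b * c \<le> sum f B"
    unfolding b_def using B(3) by (rule sum_bounded_below)
  also have "\<dots> \<le> sum f (I - N)"
    using fin BN by (intro sum_mono2) (auto simp: N_def)
  also have "\<dots> = - sum f N" using sum_diff[OF fin N(1), of f] zero by simp
  finally have "(b * c)\<^sup>2 \<le> (- sum f N)\<^sup>2"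
    using b True by (intro power_mono) auto
  also have "\<dots> \<le> (\<Sum>i\<in>N. (f i)\<^sup>2) * m"
    using sum_squared_le_sum_of_squares[of f N] N(2) by (simp add: m_def mult.commute)
  finally have neg: "(b * c)\<^sup>2 \<le> (\<Sum>i\<in>N. (f i)\<^sup>2) * m" .
  have "b * c\<^sup>2 \<le> (\<Sum>i\<in>B. (f i)\<^sup>2)"
    unfolding b_def using B(3) True by (intro sum_bounded_below power_mono) auto
  also have "\<dots> \<le> (\<Sum>i\<in>I - N. (f i)\<^sup>2)"
    using fin BN by (intro sum_mono2) auto
  \<comment> \<open>Multiplying by \<open>m\<close> instead of dividing the other estimate by it covers \<open>m = 0\<close>.\<close>
  finally have "b * c\<^sup>2 * m \<le> (\<Sum>i\<in>I - N. (f i)\<^sup>2) * m"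
    using m by (rule mult_right_mono)
  with neg have "c\<^sup>2 * (b * (b + m)) \<le> (\<Sum>i\<in>I - N. (f i)\<^sup>2) * m + (\<Sum>i\<in>N. (f i)\<^sup>2) * m"
    by (simp add: algebra_simps power2_eq_square)
  also have "\<dots> = (\<Sum>i\<in>I. (f i)\<^sup>2) * m"
    by (simp add: sum.subset_diff[OF N(1) fin] distrib_right)
  finally have "c\<^sup>2 \<le> (\<Sum>i\<in>I. (f i)\<^sup>2) * m / (b * (b + m))"
    using b m by (simp add: pos_le_divide_eq)
  then show ?thesis unfolding m_def b_def N_def by (rule real_le_rsqrt)
qed

lemma sum_list_diag_mat: "A \<in> carrier_mat n n \<Longrightarrow> sum_list (diag_mat A) = (\<Sum>i<n. A $$ (i, i))"
  by (simp add: diag_mat_def sum_list_sum_nth atLeast0LessThan)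

lemma trace_mult_commute:
  fixes A B :: "'a :: comm_semiring_0 mat"
  assumes "A \<in> carrier_mat n n" "B \<in> carrier_mat n n"
  shows "sum_list (diag_mat (A * B)) = sum_list (diag_mat (B * A))"
proof -
  have tr: "sum_list (diag_mat (X * Y)) = (\<Sum>i<n. \<Sum>j<n. X $$ (i, j) * Y $$ (j, i))"
    if "X \<in> carrier_mat n n" "Y \<in> carrier_mat n n" for X Y :: "'a mat"
    using that by (auto simp: sum_list_diag_mat[where n = n] scalar_prod_def atLeast0LessThan
        intro!: sum.cong)
  show ?thesis
    using assms by (simp add: tr) (subst sum.swap, simp add: mult.commute)
qed

text \<open>
  The trace is a similarity invariant, and Schur's triangular form of \<open>A\<close> has the eigenvalues on
  its diagonal.
\<close>

lemma trace_eq_sum_eigenvalues: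
  fixes A :: "real mat"
  assumes A: "A \<in> carrier_mat n n" and es: "char_poly A = (\<Prod>a\<leftarrow>es. [:- a, 1:])"
  shows "sum_list (diag_mat A) = sum_list es"
proof -
  obtain B P Q where BPQ: "schur_decomposition A es = (B, P, Q)" by (metis prod_cases3)
  note schur = schur_decomposition[OF A es BPQ]
  from schur have B: "diag_mat B = es" and wit: "similar_mat_wit A B P Q" by auto
  note car = similar_mat_witD2[OF A wit]
  have "sum_list (diag_mat A) = sum_list (diag_mat (P * (B * Q)))"
    using car by (simp add: assoc_mult_mat[of _ n n _ n _ n])
  also have "\<dots> = sum_list (diag_mat (B * Q * P))"
    using car by (intro trace_mult_commute) auto
  also have "B * Q * P = B"
    using car by (simp add: assoc_mult_mat[of _ n n _ n _ n])
  finally show ?thesis by (simp add: B)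
qed

lemma (in wf_digraph) graph_dist_self: "u \<in> verts G \<Longrightarrow> graph_dist G u u = 0"
  unfolding graph_dist_def by (rule Least_eq_0) (auto simp: apath_Nil_iff)

lemma sum_distance_eigenvalues:
  assumes "Digraph.graph G" "Digraph_Component.connected G" "set vs = verts G"
  shows "sum_list (distance_eigenvalues G vs) = 0"
proof -
  interpret graph G by fact
  let ?D = "distance_matrix G vs"
  obtain es where es: "char_poly ?D = (\<Prod>a\<leftarrow>es. [:- a, 1:])"
    "mset (distance_eigenvalues G vs) = mset es"
    using distance_matrix_splits[OF assms] by blast
  have car: "?D \<in> carrier_mat (length vs) (length vs)" by (simp add: distance_matrix_def)
  have "vs ! i \<in> verts G" if "i < length vs" for i using that assms(3) nth_mem by blast
  then have "(\<Sum>i<length vs. ?D $$ (i, i)) = 0"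
    by (simp add: distance_matrix_def graph_dist_self)
  then have "sum_list es = 0"
    using trace_eq_sum_eigenvalues[OF car es(1)] sum_list_diag_mat[OF car] by simp
  then show ?thesis using es(2) by (metis sum_mset_sum_list)
qed

lemma distance_eigenvalues_antimono:
  assumes "i \<le> j" "j < length (distance_eigenvalues G vs)"
  shows "distance_eigenvalues G vs ! j \<le> distance_eigenvalues G vs ! i"
  by (rule sorted_rev_nth_mono[OF _ assms]) (simp add: distance_eigenvalues_def)

theorem theorem2p1:
  fixes G :: "('a, 'b) pre_digraph" and vs :: "'a list" and n t :: nat
  assumes "Digraph.graph G" and "Digraph_Component.connected G"
    and "distinct vs" and "set vs = verts G" and "n = card (verts G)"
    and "1 \<le> t" and "t \<le> n"
  shows
    "- sqrt (S_D G vs * real (n_plus G vs)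
          / ((real n - real t + 1) * (real n - real t + 1 + real (n_plus G vs))))
       \<le> distance_eigenvalues G vs ! (t - 1)
     \<and> distance_eigenvalues G vs ! (t - 1)
       \<le> sqrt (S_D G vs * real (n_minus G vs)
          / (real t * (real t + real (n_minus G vs))))"
proof -
  let ?r = "\<lambda>i. distance_eigenvalues G vs ! i"
  have len: "length (distance_eigenvalues G vs) = n"
    using length_distance_eigenvalues[OF assms(1,2,4)] distinct_card[OF assms(3)] assms(4,5)
    by simp
  have zero: "sum ?r {..<n} = 0"
    using sum_distance_eigenvalues[OF assms(1,2,4)] len
    by (simp add: sum_list_sum_nth atLeast0LessThan)
  have S: "S_D G vs = (\<Sum>i<n. (?r i)\<^sup>2)"
    using len by (simp add: S_D_def sum_list_sum_nth atLeast0LessThan)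
  have minus: "n_minus G vs = card {i \<in> {..<n}. ?r i < 0}"
    and plus: "n_plus G vs = card {i \<in> {..<n}. - ?r i < 0}"
    using len by (simp_all add: n_minus_def n_plus_def length_filter_conv_card)
  have card: "real (card {t - 1..<n}) = real n - real t + 1"
    using assms(6,7) by (simp add: of_nat_diff)
  have "?r (t - 1) \<le> sqrt (S_D G vs * real (n_minus G vs)
          / (real (card {..<t}) * (real (card {..<t}) + real (n_minus G vs))))"
    unfolding S minus using assms(6,7) zero len
    by (intro zero_sum_bound distance_eigenvalues_antimono) (auto simp: lessThan_empty_iff)
  moreover have "- ?r (t - 1) \<le> sqrt ((\<Sum>i<n. (- ?r i)\<^sup>2) * real (n_plus G vs)
          / ((real n - real t + 1) * (real n - real t + 1 + real (n_plus G vs))))"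
    unfolding plus card[symmetric] using assms(6,7) zero len
    by (intro zero_sum_bound) (auto simp: sum_negf intro: distance_eigenvalues_antimono)
  ultimately show ?thesis by (simp add: S minus_le_iff)
qed

end
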